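(* Let $(X,\{T_s\}_{s\in S})$ be a PSPDS and let $x,y\in X$. If $x$ and $y$ are proximal, then there is a minimal left ideal $L$ of $\beta S$ such that $T_u(x)=T_u(y)$ for all $u\in L$.
   Context: A partial semigroup is a nonempty set $S$ with a partially defined operation $\bullet$ such that $(x\bullet y)\bullet z=x\bullet(y\bullet z)$ in the sense that if either side is defined so is the other and they are equal. $R(s)=\{t:s\bullet t\text{ defined}\}$. $\beta S$: ultrafilters on $S$, $\overline{A}=\{p:A\in p\}$; $s^{-1}A=\{t\in R(s):s\bullet t\in A\}$; for $p\in\beta S$, $L(p)=\{s\in S:R(s)\in p\}$; for $p,q$ with $L(q)\in p$, $p\bullet q=\{A:\{s:s^{-1}A\in q\}\in p\}$, making $\beta S$ a partial semigroup. A left ideal of $\beta S$ is a nonempty $I$ with $y\bullet x\in I$ whenever $x\in I$ and $y\bullet x$ is defined; a minimal left ideal contains no other left ideal. A PSPDS $(X,\{T_s\}_{s\in S})$: $X$ compact Hausdorff, $S$ a partial semigroup, each $T_s:R(s)\to X$ continuous with $R(s)=\mathrm{Dom}(T_s)$ nonempty compact; for each $x\in X$, $L(x)=\{s\in S:T_s(x)\text{ defined}\}$ is nonempty; $\{L(x):x\in X\}$ has the finite intersection property; $T_s\circ T_t(x)=T_{s\bullet t}(x)$ whenever $s\bullet t$ is defined. For $p\in\overline{L(x)}$, $T_p(x)$ is the unique $z$ with $\{s\in L(x):T_s(x)\in U\}\in p$ for every neighborhood $U$ of $z$. $x,y$ are proximal if some net $\langle s_l\rangle$ in $L(x)\cap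 L(y)$ has $T_{s_l}(x)$, $T_{s_l}(y)$ converging to the same point. *)

theory Defs
  imports Complex_Main
begin

text \<open>A partial semigroup is a type (hence nonempty) with an operation into \<open>option\<close>, where
  \<open>None\<close> means undefined. \<open>Option.bind\<close> is strict, so equality of the two bracketings as options
  says that if either side is defined then so is the other and they are equal.\<close>

definition partial_semigroup :: "('s \<Rightarrow> 's \<Rightarrow> 's option) \<Rightarrow> bool" where
  "partial_semigroup m \<longleftrightarrow>
     (\<forall>x y z. Option.bind (m x y) (\<lambda>u. m u z) = Option.bind (m y z) (\<lambda>v. m x v))"

definition R_set :: "('s \<Rightarrow> 's \<Rightarrow> 's option) \<Rightarrow> 's \<Rightarrow> 's set" where
  "R_set m s = {t. m s t \<noteq> None}"

definition left_quotient :: "('s \<Rightarrow> 's \<Rightarrow> 's option) \<Rightarrow> 's \<Rightarrow> 's set \<Rightarrow> 's set" where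
  "left_quotient m s A = {t \<in> R_set m s. the (m s t) \<in> A}"

definition ultrafilter :: "'s set set \<Rightarrow> bool" where
  "ultrafilter p \<longleftrightarrow> UNIV \<in> p \<and> {} \<notin> p \<and>
     (\<forall>A\<in>p. \<forall>B\<in>p. A \<inter> B \<in> p) \<and>
     (\<forall>A\<in>p. \<forall>B. A \<subseteq> B \<longrightarrow> B \<in> p) \<and>
     (\<forall>A. A \<in> p \<or> - A \<in> p)"

definition beta :: "'s set set set" where
  "beta = {p. ultrafilter p}"

definition L_beta :: "('s \<Rightarrow> 's \<Rightarrow> 's option) \<Rightarrow> 's set set \<Rightarrow> 's set" where
  "L_beta m p = {s. R_set m s \<in> p}"

definition beta_op ::
  "('s \<Rightarrow> 's \<Rightarrow> 's option) \<Rightarrow> 's set set \<Rightarrow> 's set set \<Rightarrow> 's set set option" where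
  "beta_op m p q =
     (if L_beta m q \<in> p then Some {A. {s. left_quotient m s A \<in> q} \<in> p} else None)"

definition left_ideal_beta :: "('s \<Rightarrow> 's \<Rightarrow> 's option) \<Rightarrow> 's set set set \<Rightarrow> bool" where
  "left_ideal_beta m I \<longleftrightarrow> I \<subseteq> beta \<and> I \<noteq> {} \<and>
     (\<forall>p\<in>I. \<forall>q\<in>beta. \<forall>r. beta_op m q p = Some r \<longrightarrow> r \<in> I)"

definition minimal_left_ideal_beta :: "('s \<Rightarrow> 's \<Rightarrow> 's option) \<Rightarrow> 's set set set \<Rightarrow> bool" where
  "minimal_left_ideal_beta m I \<longleftrightarrow> left_ideal_beta m I \<and>
     (\<forall>J. left_ideal_beta m J \<longrightarrow> J \<subseteq> I \<longrightarrow> J = I)"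

definition L_point :: "('s \<Rightarrow> 'x \<Rightarrow> 'x option) \<Rightarrow> 'x \<Rightarrow> 's set" where
  "L_point T x = {s. x \<in> dom (T s)}"

text \<open>The last clause is the law that \<open>T\<^sub>s (T\<^sub>t x)\<close> equals \<open>T\<^sub>s\<^sub>t x\<close> whenever the product \<open>st\<close> is
  defined. It is read, for every \<open>x\<close> at which \<open>T\<^sub>t\<close> is defined, as an equation between points of
  the space, so it includes that both sides are defined. It says nothing about an \<open>x\<close> outside
  the domain of \<open>T\<^sub>t\<close>.\<close>

definition pspds :: "('s \<Rightarrow> 's \<Rightarrow> 's option) \<Rightarrow> ('s \<Rightarrow> 'x::t2_space \<Rightarrow> 'x option) \<Rightarrow> bool" where
  "pspds m T \<longleftrightarrow>
     compact (UNIV :: 'x set) \<and>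
     partial_semigroup m \<and>
     (\<forall>s. dom (T s) \<noteq> {} \<and> compact (dom (T s)) \<and>
          continuous_on (dom (T s)) (\<lambda>x. the (T s x))) \<and>
     (\<forall>x. L_point T x \<noteq> {}) \<and>
     (\<forall>F. finite F \<longrightarrow> (\<Inter>x\<in>F. L_point T x) \<noteq> {}) \<and>
     (\<forall>s t st x. m s t = Some st \<longrightarrow> x \<in> dom (T t) \<longrightarrow>
          (\<exists>z. (T s \<circ>\<^sub>m T t) x = Some z \<and> T st x = Some z))"

definition T_beta ::
  "('s \<Rightarrow> 'x::t2_space \<Rightarrow> 'x option) \<Rightarrow> 's set set \<Rightarrow> 'x \<Rightarrow> 'x option" where
  "T_beta T p x =
     (if L_point T x \<in> p
      then Some (THE z. \<forall>U. open U \<longrightarrow> z \<in> U \<longrightarrow> {s \<in> L_point T x. the (T s x) \<in> U} \<in> p)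
      else None)"

definition directed_preorder :: "'d set \<Rightarrow> ('d \<Rightarrow> 'd \<Rightarrow> bool) \<Rightarrow> bool" where
  "directed_preorder D le \<longleftrightarrow> D \<noteq> {} \<and>
     (\<forall>a\<in>D. le a a) \<and>
     (\<forall>a\<in>D. \<forall>b\<in>D. \<forall>c\<in>D. le a b \<longrightarrow> le b c \<longrightarrow> le a c) \<and>
     (\<forall>a\<in>D. \<forall>b\<in>D. \<exists>c\<in>D. le a c \<and> le b c)"

definition net_converges ::
  "'d set \<Rightarrow> ('d \<Rightarrow> 'd \<Rightarrow> bool) \<Rightarrow> ('d \<Rightarrow> 'x::topological_space) \<Rightarrow> 'x \<Rightarrow> bool" where
  "net_converges D le f z \<longleftrightarrow>
     (\<forall>U. open U \<longrightarrow> z \<in> U \<longrightarrow> (\<exists>a\<in>D. \<forall>b\<in>D. le a b \<longrightarrow> f b \<in> U))"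

text \<open>HOL cannot quantify existentially over the index type of the net, so that type is a
  parameter. In a theorem that assumes proximality, the type variable is universally quantified,
  which amounts to a net over an arbitrary index set.\<close>

definition proximal ::
  "'d itself \<Rightarrow> ('s \<Rightarrow> 'x::t2_space \<Rightarrow> 'x option) \<Rightarrow> 'x \<Rightarrow> 'x \<Rightarrow> bool" where
  "proximal ty T x y \<longleftrightarrow>
     (\<exists>(D :: 'd set) le (\<sigma> :: 'd \<Rightarrow> 's) z. directed_preorder D le \<and>
        (\<forall>l\<in>D. \<sigma> l \<in> L_point T x \<inter> L_point T y) \<and>
        net_converges D le (\<lambda>l. the (T (\<sigma> l) x)) z \<and>
        net_converges D le (\<lambda>l. the (T (\<sigma> l) y)) z)"

end

theory Submission
  imports Defs
begin

text \<open>A net witnessing proximality yields an ultrafilter \<open>p\<close> with \<open>T\<^sub>p x = T\<^sub>p y\<close>. Since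
  \<open>T\<^sub>q\<^sub>p x = T\<^sub>q (T\<^sub>p x)\<close> whenever \<open>qp\<close> is defined (closedness of the domains \<open>R(s)\<close> makes
  \<open>T\<^sub>q (T\<^sub>p x)\<close> defined), \<open>T\<^sub>u x = T\<^sub>u y\<close> holds for every \<open>u\<close> in the left ideal
  \<open>{p} \<union> \<beta>S p\<close>. Principal left ideals are closed in \<open>\<beta>S\<close>, so by compactness and Zorn's lemma
  this one contains a minimal principal left ideal, which is a minimal left ideal.\<close>

section \<open>Ultrafilters\<close>

lemma ultrafilter_UNIV: "ultrafilter p \<Longrightarrow> UNIV \<in> p"
  and ultrafilter_empty: "ultrafilter p \<Longrightarrow> {} \<notin> p"
  and ultrafilter_Int: "ultrafilter p \<Longrightarrow> A \<in> p \<Longrightarrow> B \<in> p \<Longrightarrow> A \<inter> B \<in> p"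
  and ultrafilter_mono: "ultrafilter p \<Longrightarrow> A \<in> p \<Longrightarrow> A \<subseteq> B \<Longrightarrow> B \<in> p"
  and ultrafilter_cases: "ultrafilter p \<Longrightarrow> A \<in> p \<or> - A \<in> p"
  unfolding ultrafilter_def by blast+

lemma ultrafilter_nonempty: "ultrafilter p \<Longrightarrow> A \<in> p \<Longrightarrow> A \<noteq> {}"
  using ultrafilter_empty by blast

lemma ultrafilter_Compl_iff: "ultrafilter p \<Longrightarrow> - A \<in> p \<longleftrightarrow> A \<notin> p"
  using ultrafilter_Int[of p A "- A"] ultrafilter_empty ultrafilter_cases by fastforce

lemma ultrafilter_finite_Union:
  assumes "ultrafilter p" "finite I" "(\<Union>i\<in>I. A i) \<in> p"
  shows "\<exists>i\<in>I. A i \<in> p"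
  using assms(2,3)
proof (induction I rule: finite_induct)
  case empty
  then show ?case using ultrafilter_empty[OF assms(1)] by simp
next
  case (insert i I)
  show ?case
  proof (cases "A i \<in> p")
    case False
    then have "- A i \<in> p" using ultrafilter_cases[OF assms(1)] by blast
    from ultrafilter_Int[OF assms(1) this insert.prems]
    have "(\<Union>i\<in>I. A i) \<in> p" by (rule ultrafilter_mono[OF assms(1)]) auto
    then show ?thesis using insert.IH by blast
  qed blast
qed

text \<open>Ultrafilters are maximal: a set in \<open>q\<close> but not in \<open>p\<close> would
  have its complement in \<open>p\<close>, hence in \<open>q\<close> as well.\<close>

lemma ultrafilter_eqI:
  assumes "ultrafilter p" "ultrafilter q" "p \<subseteq> q"
  shows "p = q"
  using assms ultrafilter_Compl_iff by blast

text \<open>Zorn's lemma on proper filters containing \<open>B\<close>; a maximal one decides every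
  set. The base is assumed downward directed, which spares finite intersections.\<close>

lemma ultrafilter_extends_base:
  fixes B :: "'a set set"
  assumes "B \<noteq> {}" "{} \<notin> B"
    and "\<And>A C. A \<in> B \<Longrightarrow> C \<in> B \<Longrightarrow> \<exists>D\<in>B. D \<subseteq> A \<inter> C"
  obtains p where "ultrafilter p" "B \<subseteq> p"
proof -
  define filt where "filt G \<longleftrightarrow> UNIV \<in> G \<and> {} \<notin> G \<and> (\<forall>A\<in>G. \<forall>C\<in>G. A \<inter> C \<in> G) \<and>
     (\<forall>A\<in>G. \<forall>C. A \<subseteq> C \<longrightarrow> C \<in> G)" for G :: "'a set set"
  let ?F = "{G. filt G \<and> B \<subseteq> G}"
  have "\<exists>M\<in>?F. \<forall>X\<in>?F. M \<subseteq> X \<longrightarrow> X = M"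
  proof (rule subset_Zorn_nonempty)
    \<comment> \<open>The upward closure of \<open>B\<close> is a first candidate, as Zorn's lemma
      requires.\<close>
    have "filt {A. \<exists>C\<in>B. C \<subseteq> A}"
      unfolding filt_def
    proof (intro conjI ballI allI impI)
      fix A C assume "A \<in> {A. \<exists>C\<in>B. C \<subseteq> A}" "C \<in> {A. \<exists>C\<in>B. C \<subseteq> A}"
      then obtain A' C' where "A' \<in> B" "C' \<in> B" "A' \<subseteq> A" "C' \<subseteq> C" by blast
      moreover from assms(3)[OF this(1,2)] obtain D where "D \<in> B" "D \<subseteq> A' \<inter> C'" by blast
      ultimately show "A \<inter> C \<in> {A. \<exists>C\<in>B. C \<subseteq> A}" by blast
    next
      show "{} \<notin> {A. \<exists>C\<in>B. C \<subseteq> A}" using assms(2) by auto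
    qed (use assms(1) in blast)+
    then show "?F \<noteq> {}" by blast
  next
    fix \<C> assume ne: "\<C> \<noteq> {}" and chain: "subset.chain ?F \<C>"
    then have f: "filt G" "B \<subseteq> G" if "G \<in> \<C>" for G
      using that by (auto simp: subset.chain_def)
    have "filt (\<Union>\<C>)"
      unfolding filt_def
    proof (intro conjI ballI allI impI)
      fix A C assume "A \<in> \<Union>\<C>" "C \<in> \<Union>\<C>"
      then obtain G H where GH: "G \<in> \<C>" "H \<in> \<C>" "A \<in> G" "C \<in> H" by blast
      then have "G \<subseteq> H \<or> H \<subseteq> G" using chain by (simp add: subset_chain_def)
      then show "A \<inter> C \<in> \<Union>\<C>" using GH f(1) unfolding filt_def by blast
    next
      show "UNIV \<in> \<Union>\<C>" using ne f(1) unfolding filt_def by blast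
      show "{} \<notin> \<Union>\<C>" using f(1) unfolding filt_def by blast
    next
      fix A C assume "A \<in> \<Union>\<C>" "A \<subseteq> C"
      then obtain G where "G \<in> \<C>" "A \<in> G" by blast
      then show "C \<in> \<Union>\<C>" using f(1)[of G] \<open>A \<subseteq> C\<close> unfolding filt_def by blast
    qed
    then show "\<Union>\<C> \<in> ?F" using ne f(2) by blast
  qed
  then obtain M where M: "filt M" "B \<subseteq> M" and max: "\<And>X. filt X \<Longrightarrow> M \<subseteq> X \<Longrightarrow> X = M"
    by (smt (verit) mem_Collect_eq subset_trans)
  have "A \<in> M \<or> - A \<in> M" for A
  proof (rule ccontr)
    assume neg: "\<not> (A \<in> M \<or> - A \<in> M)"
    \<comment> \<open>The filter generated by \<open>M\<close> and \<open>A\<close>. It is proper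
      because a \<open>D\<close> in \<open>M\<close> disjoint from \<open>A\<close> would put
      \<open>- A\<close> into \<open>M\<close>.\<close>
    let ?X = "{C. \<exists>D\<in>M. D \<inter> A \<subseteq> C}"
    have "filt ?X"
      unfolding filt_def
    proof (intro conjI ballI allI impI)
      show "{} \<notin> ?X"
      proof
        assume "{} \<in> ?X"
        then obtain D where "D \<in> M" "D \<subseteq> - A" by blast
        then show False using neg M(1) unfolding filt_def by blast
      qed
    next
      fix C D assume "C \<in> ?X" "D \<in> ?X"
      then obtain C' D' where "C' \<in> M" "D' \<in> M" "C' \<inter> A \<subseteq> C" "D' \<inter> A \<subseteq> D" by blast
      moreover from this have "C' \<inter> D' \<in> M" using M(1) unfolding filt_def by blast
      moreover have "C' \<inter> D' \<inter> A \<subseteq> C \<inter> D" using calculation(3,4) by blast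
      ultimately show "C \<inter> D \<in> ?X" by (intro CollectI bexI)
    qed (use M(1) in \<open>auto simp: filt_def\<close>)
    then have "?X = M" by (rule max) blast
    moreover have "A \<in> ?X" using M(1) unfolding filt_def by blast
    ultimately show False using neg by blast
  qed
  then have "ultrafilter M" using M(1) unfolding ultrafilter_def filt_def by blast
  then show ?thesis using that M(2) by blast
qed

section \<open>The partial semigroup of ultrafilters\<close>

text \<open>Definedness of a product of ultrafilters becomes the case \<open>A = UNIV\<close> of its
  membership condition.\<close>

lemma L_beta_eq: "L_beta m p = {s. left_quotient m s UNIV \<in> p}"
  by (simp add: L_beta_def left_quotient_def)

lemma left_quotient_Int: "left_quotient m s (A \<inter> B) = left_quotient m s A \<inter> left_quotient m s B"
  by (auto simp: left_quotient_def)

lemma left_quotient_mono: "A \<subseteq> B \<Longrightarrow> left_quotient m s A \<subseteq> left_quotient m s B"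
  by (auto simp: left_quotient_def)

lemma mem_left_quotient: "t \<in> left_quotient m s A \<longleftrightarrow> (\<exists>u. m s t = Some u \<and> u \<in> A)"
  by (auto simp: left_quotient_def R_set_def)

text \<open>Partial associativity read on quotients. If \<open>m s t\<close> is \<open>None\<close>,
  then no \<open>v\<close> makes \<open>Option.bind (m t v) (m s)\<close> defined, which accounts
  for the empty set.\<close>

lemma left_quotient_left_quotient:
  assumes "partial_semigroup m"
  shows "left_quotient m t (left_quotient m s A) =
    (case m s t of None \<Rightarrow> {} | Some u \<Rightarrow> left_quotient m u A)"
proof -
  have "v \<in> left_quotient m t (left_quotient m s A) \<longleftrightarrow>
      (\<exists>w. Option.bind (m t v) (m s) = Some w \<and> w \<in> A)" for v
    by (auto simp: mem_left_quotient bind_eq_Some_conv)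
  moreover have "Option.bind (m t v) (m s) = Option.bind (m s t) (\<lambda>u. m u v)" for v
    using assms unfolding partial_semigroup_def by metis
  ultimately show ?thesis
    by (auto simp: mem_left_quotient split: option.splits)
qed

text \<open>A \<open>t\<close> with \<open>m s t = None\<close> is outside the right-hand set, and
  outside the left-hand one because its iterated quotient is empty. This identity drives
  associativity for ultrafilters.\<close>

lemma left_quotient_preimage:
  assumes "partial_semigroup m" "{} \<notin> p"
  shows "{t. left_quotient m t (left_quotient m s A) \<in> p} =
    left_quotient m s {t. left_quotient m t A \<in> p}"
  using assms(2)
  by (auto simp: left_quotient_left_quotient[OF assms(1)] mem_left_quotient split: option.splits)

lemma beta_op_SomeD:
  assumes "beta_op m q p = Some r"
  shows "L_beta m p \<in> q" "A \<in> r \<longleftrightarrow> {s. left_quotient m s A \<in> p} \<in> q"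
  using assms by (auto simp: beta_op_def split: if_splits)

text \<open>The delicate point is the dichotomy: \<open>left_quotient m s (- A)\<close> complements
  \<open>left_quotient m s A\<close> only within \<open>R_set m s\<close>. Definedness of the
  product says that \<open>R_set m s\<close> is in \<open>p\<close> for \<open>q\<close>-most
  \<open>s\<close>.\<close>

lemma ultrafilter_beta_op:
  assumes p: "ultrafilter p" and q: "ultrafilter q" and r: "beta_op m q p = Some r"
  shows "ultrafilter r"
  unfolding ultrafilter_def
proof (intro conjI ballI allI impI)
  note mem = beta_op_SomeD(2)[OF r]
  show "UNIV \<in> r" using beta_op_SomeD(1)[OF r] by (simp add: mem L_beta_eq)
  show "{} \<notin> r"
    using ultrafilter_empty[OF p] ultrafilter_empty[OF q] by (simp add: mem left_quotient_def)
  fix A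
  show "A \<inter> B \<in> r" if "A \<in> r" "B \<in> r" for B
  proof -
    have "{s. left_quotient m s A \<in> p} \<inter> {s. left_quotient m s B \<in> p} \<in> q"
      using that by (simp add: mem ultrafilter_Int[OF q])
    then show ?thesis
      unfolding mem
      by (rule ultrafilter_mono[OF q]) (auto simp: left_quotient_Int ultrafilter_Int[OF p])
  qed
  show "B \<in> r" if "A \<in> r" "A \<subseteq> B" for B
    using that(1) unfolding mem
    by (rule ultrafilter_mono[OF q])
      (use ultrafilter_mono[OF p] left_quotient_mono[OF that(2)] in blast)
  show "A \<in> r \<or> - A \<in> r"
  proof (rule disjCI)
    assume "- A \<notin> r"
    then have "- {s. left_quotient m s (- A) \<in> p} \<inter> L_beta m p \<in> q"
      using ultrafilter_Int[OF q] beta_op_SomeD(1)[OF r] ultrafilter_cases[OF q]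
      unfolding mem by blast
    then show "A \<in> r"
      unfolding mem
    proof (rule ultrafilter_mono[OF q], safe)
      fix s assume s: "left_quotient m s (- A) \<notin> p" "s \<in> L_beta m p"
      then have "- left_quotient m s (- A) \<inter> R_set m s \<in> p"
        using ultrafilter_Int[OF p] ultrafilter_cases[OF p] unfolding L_beta_def by blast
      then show "left_quotient m s A \<in> p"
        by (rule ultrafilter_mono[OF p]) (auto simp: left_quotient_def)
    qed
  qed
qed

text \<open>By \<open>pre\<close>, both bracketings have the same membership condition, so what
  remains is definedness. Left ideals need this direction of associativity.\<close>

lemma beta_op_assoc:
  assumes m: "partial_semigroup m" and p: "ultrafilter p" and q: "ultrafilter q"
    and r: "ultrafilter r"
    and qp: "beta_op m q p = Some qp" and rqp: "beta_op m r qp = Some t"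
  obtains u where "beta_op m r q = Some u" "beta_op m u p = Some t"
proof -
  have pre: "left_quotient m s A \<in> qp \<longleftrightarrow> left_quotient m s {t. left_quotient m t A \<in> p} \<in> q" for s A
    unfolding beta_op_SomeD(2)[OF qp]
    by (simp add: left_quotient_preimage[OF m ultrafilter_empty[OF p]])
  \<comment> \<open>By \<open>pre\<close>, \<open>s\<close> is in \<open>L_beta m qp\<close> when
    the quotient of \<open>L_beta m p\<close> by \<open>s\<close> is in \<open>q\<close>; enlarging
    \<open>L_beta m p\<close> to \<open>UNIV\<close> gives \<open>R_set m s\<close> in
    \<open>q\<close>.\<close>
  have "L_beta m qp \<subseteq> L_beta m q"
    unfolding L_beta_eq pre
    by (auto intro: ultrafilter_mono[OF q _ left_quotient_mono[OF subset_UNIV]])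
  then have "L_beta m q \<in> r" using beta_op_SomeD(1)[OF rqp] ultrafilter_mono[OF r] by blast
  then obtain u where u: "beta_op m r q = Some u" by (simp add: beta_op_def)
  have "L_beta m p \<in> u"
    using beta_op_SomeD(1)[OF rqp] unfolding beta_op_SomeD(2)[OF u] L_beta_eq pre .
  moreover have "t = {A. {s. left_quotient m s A \<in> p} \<in> u}"
    by (auto simp: beta_op_SomeD(2)[OF rqp] beta_op_SomeD(2)[OF u] pre)
  ultimately have "beta_op m u p = Some t" by (simp add: beta_op_def)
  with u show ?thesis using that by blast
qed

section \<open>Minimal left ideals\<close>

text \<open>The point \<open>p\<close> is adjoined because there need not be an identity, and
  possibly no product with right factor \<open>p\<close> is defined.\<close>

definition principal_left_ideal ::
  "('s \<Rightarrow> 's \<Rightarrow> 's option) \<Rightarrow> 's set set \<Rightarrow> 's set set set" where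
  "principal_left_ideal m p = insert p {r. \<exists>q\<in>beta. beta_op m q p = Some r}"

lemma mem_principal_left_ideal: "p \<in> principal_left_ideal m p"
  by (simp add: principal_left_ideal_def)

lemma principal_left_ideal_subset_beta:
  assumes "p \<in> beta"
  shows "principal_left_ideal m p \<subseteq> beta"
  using assms ultrafilter_beta_op by (auto simp: principal_left_ideal_def beta_def)

lemma left_ideal_principal:
  assumes "partial_semigroup m" "p \<in> beta"
  shows "left_ideal_beta m (principal_left_ideal m p)"
  unfolding left_ideal_beta_def
proof (intro conjI ballI allI impI)
  show "principal_left_ideal m p \<subseteq> beta" by (rule principal_left_ideal_subset_beta[OF assms(2)])
  show "principal_left_ideal m p \<noteq> {}" using mem_principal_left_ideal by blast
next
  fix w r t assume "w \<in> principal_left_ideal m p" and r: "r \<in> beta" and t: "beta_op m r w = Some t"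
  then consider "w = p" | q where "q \<in> beta" "beta_op m q p = Some w"
    by (auto simp: principal_left_ideal_def)
  then show "t \<in> principal_left_ideal m p"
  proof cases
    case 1
    then show ?thesis using r t by (auto simp: principal_left_ideal_def)
  next
    case 2
    have ultra: "ultrafilter p" "ultrafilter q" "ultrafilter r"
      using assms(2) 2(1) r by (auto simp: beta_def)
    \<comment> \<open>Reassociating moves \<open>r\<close> into the left factor and keeps
      \<open>p\<close> on the right.\<close>
    obtain u where u: "beta_op m r q = Some u" "beta_op m u p = Some t"
      by (rule beta_op_assoc[OF assms(1) ultra 2(2) t])
    have "u \<in> beta" using ultrafilter_beta_op[OF ultra(2,3) u(1)] by (simp add: beta_def)
    then show ?thesis using u(2) by (auto simp: principal_left_ideal_def)
  qed
qed

lemma principal_left_ideal_least: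
  assumes "left_ideal_beta m J" "p \<in> J"
  shows "principal_left_ideal m p \<subseteq> J"
  using assms by (auto simp: principal_left_ideal_def left_ideal_beta_def)

text \<open>An ultrafilter is in the closure of a set of ultrafilters iff it contains the intersection
  of that set.\<close>

lemma principal_left_ideal_closed:
  assumes p: "p \<in> beta" and r: "r \<in> beta" and sub: "\<Inter>(principal_left_ideal m p) \<subseteq> r"
  shows "r \<in> principal_left_ideal m p"
proof (cases "r = p")
  case True
  then show ?thesis by (simp add: mem_principal_left_ideal)
next
  case False
  have up: "ultrafilter p" and ur: "ultrafilter r" using p r by (auto simp: beta_def)
  \<comment> \<open>Intersecting with \<open>- A0\<close> keeps the approximants of \<open>r\<close>
    away from \<open>p\<close>, so that they are genuine products \<open>q p\<close>.\<close>
  obtain A0 where A0: "A0 \<in> p" "A0 \<notin> r" using False ultrafilter_eqI[OF up ur] by blast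
  \<comment> \<open>Any \<open>q\<close> whose product with \<open>p\<close> is \<open>r\<close>
    must contain \<open>P A\<close> for every \<open>A\<close> in \<open>r\<close>. These sets will
    serve as a base for constructing such a \<open>q\<close>.\<close>
  define P where "P A = {s \<in> L_beta m p. left_quotient m s A \<in> p}" for A
  have P_nonempty: "P A \<noteq> {}" if "A \<in> r" for A
  proof -
    have "A \<inter> - A0 \<in> r"
      using that A0(2) ultrafilter_Compl_iff[OF ur] ultrafilter_Int[OF ur] by blast
    then have "- (A \<inter> - A0) \<notin> r" using ultrafilter_Compl_iff[OF ur] by blast
    \<comment> \<open>A set outside \<open>r\<close> is outside the intersection of the ideal, so
      some member \<open>w\<close> of the ideal omits it.\<close>
    then obtain w where w: "w \<in> principal_left_ideal m p" "- (A \<inter> - A0) \<notin> w" using sub by blast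
    have "w \<noteq> p" using w(2) A0(1) ultrafilter_mono[OF up A0(1), of "- (A \<inter> - A0)"] by blast
    then obtain q where q: "q \<in> beta" "beta_op m q p = Some w"
      using w(1) by (auto simp: principal_left_ideal_def)
    have uq: "ultrafilter q" and uw: "ultrafilter w"
      using q w(1) principal_left_ideal_subset_beta[OF p] by (auto simp: beta_def)
    have "A \<in> w" using w(2) ultrafilter_Compl_iff[OF uw] ultrafilter_mono[OF uw] by blast
    then have "L_beta m p \<inter> {s. left_quotient m s A \<in> p} \<in> q"
      using beta_op_SomeD[OF q(2)] ultrafilter_Int[OF uq] by blast
    from ultrafilter_nonempty[OF uq this] show ?thesis unfolding P_def by blast
  qed
  have P_Int: "P (A \<inter> C) \<subseteq> P A \<inter> P C" for A C
    using ultrafilter_mono[OF up] by (auto simp: P_def left_quotient_Int)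
  obtain q where q: "ultrafilter q" "P ` r \<subseteq> q"
  proof (rule ultrafilter_extends_base[of "P ` r"])
    show "P ` r \<noteq> {}" using ultrafilter_UNIV[OF ur] by blast
    show "{} \<notin> P ` r" using P_nonempty by force
    show "\<exists>D\<in>P ` r. D \<subseteq> A \<inter> C" if "A \<in> P ` r" "C \<in> P ` r" for A C
    proof -
      from that obtain A' C' where "A' \<in> r" "C' \<in> r" "A = P A'" "C = P C'" by blast
      then show ?thesis using P_Int[of A' C'] ultrafilter_Int[OF ur, of A' C'] by blast
    qed
  qed
  have "P UNIV \<in> q" using q(2) ultrafilter_UNIV[OF ur] by blast
  then have "L_beta m p \<in> q" by (rule ultrafilter_mono[OF q(1)]) (auto simp: P_def)
  then obtain w where w: "beta_op m q p = Some w" by (simp add: beta_op_def)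
  have "r \<subseteq> w"
  proof
    fix A assume "A \<in> r"
    then have "P A \<in> q" using q(2) by blast
    then show "A \<in> w"
      unfolding beta_op_SomeD(2)[OF w] by (rule ultrafilter_mono[OF q(1)]) (auto simp: P_def)
  qed
  then have "r = w" using ultrafilter_eqI[OF ur] ultrafilter_beta_op[OF up q(1) w] by blast
  then show ?thesis using w q(1) by (auto simp: principal_left_ideal_def beta_def)
qed

text \<open>Compactness of the space of ultrafilters in filter form: an ultrafilter containing the
  intersection of each ideal of the chain lies in each of them, as they are closed.\<close>

lemma chain_principal_left_ideals_Inter:
  assumes ne: "P \<noteq> {}" and beta: "P \<subseteq> beta"
    and chain: "\<And>p q. p \<in> P \<Longrightarrow> q \<in> P \<Longrightarrow>
      principal_left_ideal m p \<subseteq> principal_left_ideal m q \<or>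
      principal_left_ideal m q \<subseteq> principal_left_ideal m p"
  obtains r where "r \<in> beta" "\<forall>p\<in>P. r \<in> principal_left_ideal m p"
proof -
  let ?B = "\<Union>p\<in>P. \<Inter>(principal_left_ideal m p)"
  obtain r where r: "ultrafilter r" "?B \<subseteq> r"
  proof (rule ultrafilter_extends_base[of ?B])
    have "UNIV \<in> \<Inter>(principal_left_ideal m p)" if "p \<in> P" for p
      using principal_left_ideal_subset_beta[of p m] that beta ultrafilter_UNIV
      by (auto simp: beta_def)
    then show "?B \<noteq> {}" using ne by blast
    show "{} \<notin> ?B"
      using mem_principal_left_ideal beta ultrafilter_empty by (fastforce simp: beta_def)
    fix A C assume "A \<in> ?B" "C \<in> ?B"
    then obtain p q where pq: "p \<in> P" "q \<in> P" "A \<in> \<Inter>(principal_left_ideal m p)"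
        "C \<in> \<Inter>(principal_left_ideal m q)"
      by blast
    \<comment> \<open>The smaller of the two ideals has the larger intersection, which therefore
      contains both \<open>A\<close> and \<open>C\<close>.\<close>
    then obtain w where w: "w \<in> P" "A \<in> \<Inter>(principal_left_ideal m w)"
        "C \<in> \<Inter>(principal_left_ideal m w)"
      using chain[OF pq(1,2)] by blast
    then have "A \<inter> C \<in> \<Inter>(principal_left_ideal m w)"
      using principal_left_ideal_subset_beta[of w m] beta
      by (auto simp: beta_def intro!: ultrafilter_Int)
    then show "\<exists>D\<in>?B. D \<subseteq> A \<inter> C" using w(1) by blast
  qed
  show ?thesis
  proof (rule that)
    show "r \<in> beta" using r(1) by (simp add: beta_def)
    show "\<forall>p\<in>P. r \<in> principal_left_ideal m p"
    proof
      fix p assume "p \<in> P"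
      then show "r \<in> principal_left_ideal m p"
        using principal_left_ideal_closed[of p r m] beta r by (auto simp: beta_def)
    qed
  qed
qed

text \<open>Zorn's lemma is applied only to principal ideals of members of \<open>J\<close>. A
  common point \<open>r\<close> of a chain generates an ideal below all of it.\<close>

lemma left_ideal_contains_minimal:
  assumes m: "partial_semigroup m" and J: "left_ideal_beta m J"
  obtains L where "minimal_left_ideal_beta m L" "L \<subseteq> J"
proof -
  let ?I = "principal_left_ideal m"
  have J_beta: "J \<subseteq> beta" using J by (simp add: left_ideal_beta_def)
  have refines: "?I r \<subseteq> ?I p" if "p \<in> beta" "r \<in> ?I p" for p r
    using principal_left_ideal_least[OF left_ideal_principal[OF m that(1)] that(2)] .
  \<comment> \<open>Complements turn the search for a minimal ideal into one for a maximal
    set.\<close>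
  let ?c = "\<lambda>p. - ?I p"
  have "\<exists>M\<in>?c ` J. \<forall>X\<in>?c ` J. M \<subseteq> X \<longrightarrow> X = M"
  proof (rule subset_Zorn)
    fix \<C> assume C: "subset.chain (?c ` J) \<C>"
    show "\<exists>U\<in>?c ` J. \<forall>X\<in>\<C>. X \<subseteq> U"
    proof (cases "\<C> = {}")
      case True
      then show ?thesis using J by (auto simp: left_ideal_beta_def)
    next
      case False
      let ?P = "{p \<in> J. ?c p \<in> \<C>}"
      have P_nonempty: "?P \<noteq> {}" using False C by (auto simp: subset.chain_def)
      obtain r where r: "r \<in> beta" "\<forall>p\<in>?P. r \<in> ?I p"
      proof (rule chain_principal_left_ideals_Inter[of ?P m])
        show "?P \<noteq> {}" by (rule P_nonempty)
        show "?P \<subseteq> beta" using J_beta by blast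
        show "?I p \<subseteq> ?I q \<or> ?I q \<subseteq> ?I p" if "p \<in> ?P" "q \<in> ?P" for p q
        proof -
          have "?c p \<subseteq> ?c q \<or> ?c q \<subseteq> ?c p"
            using that C unfolding subset_chain_def by (elim conjE CollectE) (drule (1) bspec)+
          then show ?thesis by auto
        qed
      qed
      obtain p where p: "p \<in> ?P" using P_nonempty by blast
      have "r \<in> J" using r(2) principal_left_ideal_least[OF J] p by blast
      moreover have "X \<subseteq> ?c r" if X: "X \<in> \<C>" for X
      proof -
        obtain p where "p \<in> J" "X = ?c p" using X C by (auto simp: subset.chain_def)
        then show ?thesis using refines[of p r] r(2) X J_beta by blast
      qed
      ultimately show ?thesis by (intro bexI[of _ "?c r"]) auto
    qed
  qed
  then obtain p where p: "p \<in> J" and max: "\<forall>X\<in>?c ` J. ?c p \<subseteq> X \<longrightarrow> X = ?c p"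
    by (elim bexE imageE) simp
  have min: "?I q = ?I p" if "q \<in> J" "?I q \<subseteq> ?I p" for q
    using max that by simp
  have sub: "?I p \<subseteq> J" by (rule principal_left_ideal_least[OF J p])
  \<comment> \<open>Minimality among principal ideals suffices, since \<open>K\<close> contains the
    principal ideal of each of its members.\<close>
  have "K = ?I p" if K: "left_ideal_beta m K" "K \<subseteq> ?I p" for K
  proof -
    obtain q where q: "q \<in> K" using K(1) by (auto simp: left_ideal_beta_def)
    have "?I q \<subseteq> K" by (rule principal_left_ideal_least[OF K(1) q])
    moreover from this have "?I q = ?I p" using min[of q] q K(2) sub by blast
    ultimately show ?thesis using K(2) by blast
  qed
  then have "minimal_left_ideal_beta m (?I p)"
    using left_ideal_principal[OF m] p J_beta by (auto simp: minimal_left_ideal_beta_def)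
  then show ?thesis using that sub by blast
qed

section \<open>Limits along ultrafilters\<close>

text \<open>The condition under the definite description in \<open>T_beta\<close>, kept as a
  relation so that existence and uniqueness can be treated separately.\<close>

definition point_limit ::
  "('s \<Rightarrow> 'x::t2_space \<Rightarrow> 'x option) \<Rightarrow> 's set set \<Rightarrow> 'x \<Rightarrow> 'x \<Rightarrow> bool" where
  "point_limit T p x z \<longleftrightarrow>
     (\<forall>U. open U \<longrightarrow> z \<in> U \<longrightarrow> {s \<in> L_point T x. the (T s x) \<in> U} \<in> p)"

lemma point_limitD:
  "point_limit T p x z \<Longrightarrow> open U \<Longrightarrow> z \<in> U \<Longrightarrow> {s \<in> L_point T x. the (T s x) \<in> U} \<in> p"
  by (simp add: point_limit_def)

lemma point_limit_unique:
  assumes p: "ultrafilter p" and "point_limit T p x z" "point_limit T p x w"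
  shows "z = w"
proof (rule ccontr)
  assume "z \<noteq> w"
  then obtain U V where UV: "open U" "open V" "z \<in> U" "w \<in> V" "U \<inter> V = {}"
    using hausdorff[of z w] by blast
  have "{s \<in> L_point T x. the (T s x) \<in> U} \<inter> {s \<in> L_point T x. the (T s x) \<in> V} \<in> p"
    using assms UV by (intro ultrafilter_Int[OF p]) (auto intro: point_limitD)
  from ultrafilter_nonempty[OF p this] show False using UV(5) by blast
qed

lemma T_beta_eq_Some:
  assumes "ultrafilter p" "point_limit T p x z"
  shows "T_beta T p x = Some z"
proof -
  have "L_point T x \<in> p" using point_limitD[OF assms(2), of UNIV] by simp
  moreover have "(THE z. point_limit T p x z) = z"
    using assms(2) point_limit_unique[OF assms(1)] by blast
  ultimately show ?thesis by (simp add: T_beta_def point_limit_def)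
qed

text \<open>Otherwise every point has a neighborhood violating the limit condition. Finitely many of
  these cover the space, and then one of them must satisfy it, since \<open>p\<close> is prime for
  finite unions.\<close>

lemma point_limit_exists:
  fixes T :: "'s \<Rightarrow> 'x::t2_space \<Rightarrow> 'x option"
  assumes compact: "compact (UNIV :: 'x set)" and p: "ultrafilter p" and L: "L_point T x \<in> p"
  obtains z where "point_limit T p x z"
proof (rule ccontr)
  assume "\<not> thesis"
  then have "\<forall>z. \<exists>U. open U \<and> z \<in> U \<and> {s \<in> L_point T x. the (T s x) \<in> U} \<notin> p"
    using that unfolding point_limit_def by blast
  then obtain U where U: "\<And>z. open (U z)" "\<And>z. z \<in> U z"
      "\<And>z. {s \<in> L_point T x. the (T s x) \<in> U z} \<notin> p"
    by metis
  obtain F where F: "finite F" "UNIV \<subseteq> (\<Union>z\<in>F. U z)"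
  proof (rule compactE_image[OF compact, of UNIV U])
    show "UNIV \<subseteq> (\<Union>z. U z)" using U(2) by blast
  qed (use U(1) in auto)
  have "(\<Union>z\<in>F. {s \<in> L_point T x. the (T s x) \<in> U z}) = L_point T x" using F(2) by auto
  with L obtain z where "z \<in> F" "{s \<in> L_point T x. the (T s x) \<in> U z} \<in> p"
    using ultrafilter_finite_Union[OF p F(1), of "\<lambda>z. {s \<in> L_point T x. the (T s x) \<in> U z}"]
    by auto
  with U(3) show False by blast
qed

section \<open>Compatibility of limits with products\<close>

lemma pspds_compose:
  assumes "pspds m T" "m s t = Some u" "T t x = Some v"
  obtains w where "T s v = Some w" "T u x = Some w"
proof -
  have "\<forall>s t st x. m s t = Some st \<longrightarrow> x \<in> dom (T t) \<longrightarrow>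
      (\<exists>z. (T s \<circ>\<^sub>m T t) x = Some z \<and> T st x = Some z)"
    using assms(1) by (simp add: pspds_def)
  then obtain z where "(T s \<circ>\<^sub>m T t) x = Some z" "T u x = Some z"
    using assms(2,3) by blast
  then show ?thesis using that assms(3) by (simp add: map_comp_def)
qed

text \<open>If \<open>R_set m s\<close> is in \<open>p\<close>, then \<open>p\<close>-most
  \<open>t\<close> send \<open>x\<close> into \<open>dom (T s)\<close>. This domain is compact,
  hence closed, so it also contains the limit \<open>z\<close>.\<close>

lemma L_beta_subset_L_point:
  assumes S: "pspds m T" and p: "ultrafilter p" and z: "point_limit T p x z"
  shows "L_beta m p \<subseteq> L_point T z"
proof (rule ccontr)
  assume "\<not> ?thesis"
  then obtain s where s: "R_set m s \<in> p" "z \<notin> dom (T s)"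
    by (auto simp: L_beta_def L_point_def)
  have "open (- dom (T s))"
    using S by (simp add: pspds_def compact_imp_closed open_Compl)
  then have "{t \<in> L_point T x. the (T t x) \<in> - dom (T s)} \<inter> R_set m s \<in> p"
    using s by (intro ultrafilter_Int[OF p] point_limitD[OF z]) auto
  from ultrafilter_nonempty[OF p this] obtain t
    where t: "t \<in> L_point T x" "the (T t x) \<notin> dom (T s)" "t \<in> R_set m s"
    by blast
  then obtain u v where uv: "m s t = Some u" "T t x = Some v"
    by (auto simp: R_set_def L_point_def)
  obtain w where "T s v = Some w" by (rule pspds_compose[OF S uv])
  then show False using t(2) uv(2) by (simp add: domI)
qed

text \<open>The action law passes to limits: for \<open>q\<close>-most \<open>s\<close>, continuity
  of \<open>T s\<close> at \<open>z\<close> pulls \<open>U\<close> back to a neighborhood of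
  \<open>z\<close>, which \<open>T t x\<close> enters for \<open>p\<close>-most
  \<open>t\<close>.\<close>

lemma point_limit_beta_op:
  assumes S: "pspds m T" and p: "ultrafilter p" and q: "ultrafilter q"
    and r: "beta_op m q p = Some r"
    and z: "point_limit T p x z" and w: "point_limit T q z w"
  shows "point_limit T r x w"
  unfolding point_limit_def
proof (intro allI impI)
  fix U assume U: "open U" "w \<in> U"
  have "{s \<in> L_point T z. the (T s z) \<in> U} \<inter> L_beta m p \<in> q"
    using point_limitD[OF w U] beta_op_SomeD(1)[OF r] ultrafilter_Int[OF q] by blast
  then show "{s \<in> L_point T x. the (T s x) \<in> U} \<in> r"
    unfolding beta_op_SomeD(2)[OF r]
  proof (rule ultrafilter_mono[OF q], safe)
    fix s assume s: "s \<in> L_point T z" "the (T s z) \<in> U" "s \<in> L_beta m p"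
    have "continuous_on (dom (T s)) (\<lambda>x. the (T s x))" using S by (simp add: pspds_def)
    \<comment> \<open>Continuity gives only a relatively open preimage; it is extended to an open
      set \<open>V\<close> of the whole space, against which \<open>point_limit\<close> can be
      tested.\<close>
    then obtain V where V: "open V" "V \<inter> dom (T s) = (\<lambda>x. the (T s x)) -` U \<inter> dom (T s)"
      using U(1) unfolding continuous_on_open_invariant by blast
    have "z \<in> V" using s(1,2) V(2) by (auto simp: L_point_def)
    then have "{t \<in> L_point T x. the (T t x) \<in> V} \<inter> R_set m s \<in> p"
      using point_limitD[OF z V(1)] s(3) ultrafilter_Int[OF p] by (simp add: L_beta_def)
    then show "left_quotient m s {s \<in> L_point T x. the (T s x) \<in> U} \<in> p"
    proof (rule ultrafilter_mono[OF p], safe)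
      fix t assume t: "t \<in> L_point T x" "the (T t x) \<in> V" "t \<in> R_set m s"
      then obtain u v where uv: "m s t = Some u" "T t x = Some v" "v \<in> V"
        by (auto simp: R_set_def L_point_def)
      obtain w where w: "T s v = Some w" "T u x = Some w"
        by (rule pspds_compose[OF S uv(1,2)])
      have "w \<in> U" using w(1) uv(3) V(2) by force
      then show "t \<in> left_quotient m s {s \<in> L_point T x. the (T s x) \<in> U}"
        using uv(1) w(2) by (auto simp: mem_left_quotient L_point_def)
    qed
  qed
qed

text \<open>The tails of the net, pushed forward to the semigroup, form a filter base. An
  ultrafilter above it follows both orbits at once, so both have the limit \<open>z\<close> of the
  net.\<close>

lemma proximal_point_limit:
  assumes "proximal TYPE('d) T x y"
  obtains p z where "ultrafilter p" "point_limit T p x z" "point_limit T p y z"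
proof -
  obtain D :: "'d set" and le \<sigma> z where D: "directed_preorder D le"
    and \<sigma>: "\<And>l. l \<in> D \<Longrightarrow> \<sigma> l \<in> L_point T x \<inter> L_point T y"
    and lim: "net_converges D le (\<lambda>l. the (T (\<sigma> l) x)) z"
      "net_converges D le (\<lambda>l. the (T (\<sigma> l) y)) z"
    using assms unfolding proximal_def by blast
  define E where "E a = \<sigma> ` {b \<in> D. le a b}" for a
  obtain p where p: "ultrafilter p" "E ` D \<subseteq> p"
  proof (rule ultrafilter_extends_base[of "E ` D"])
    show "E ` D \<noteq> {}" using D by (simp add: directed_preorder_def)
    have "\<sigma> a \<in> E a" if "a \<in> D" for a
      using D that by (simp add: directed_preorder_def E_def)
    then show "{} \<notin> E ` D" by force
    fix A C assume "A \<in> E ` D" "C \<in> E ` D"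
    then obtain a b where ab: "a \<in> D" "b \<in> D" "A = E a" "C = E b" by blast
    then obtain c where c: "c \<in> D" "le a c" "le b c" using D unfolding directed_preorder_def by blast
    have "E c \<subseteq> E a \<inter> E b"
      using D ab(1,2) c unfolding directed_preorder_def E_def by blast
    then show "\<exists>F\<in>E ` D. F \<subseteq> A \<inter> C" using ab c(1) by blast
  qed
  have "point_limit T p v z"
    if conv: "net_converges D le (\<lambda>l. the (T (\<sigma> l) v)) z" and v: "v = x \<or> v = y" for v
    unfolding point_limit_def
  proof (intro allI impI)
    fix U assume "open U" "z \<in> U"
    then obtain a where a: "a \<in> D" "\<And>b. b \<in> D \<Longrightarrow> le a b \<Longrightarrow> the (T (\<sigma> b) v) \<in> U"
      using conv unfolding net_converges_def by metis
    have "E a \<in> p" using p(2) a(1) by blast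
    then show "{s \<in> L_point T v. the (T s v) \<in> U} \<in> p"
      by (rule ultrafilter_mono[OF p(1)]) (use a(2) \<sigma> v in \<open>auto simp: E_def\<close>)
  qed
  then show ?thesis using that p(1) lim by blast
qed

theorem theorem4p8:
  fixes m :: "'s \<Rightarrow> 's \<Rightarrow> 's option"
    and T :: "'s \<Rightarrow> 'x::t2_space \<Rightarrow> 'x option"
    and x y :: 'x
  assumes "pspds m T"
    and "proximal TYPE('d) T x y"
  shows "\<exists>L. minimal_left_ideal_beta m L \<and>
           (\<forall>u\<in>L. \<exists>z. T_beta T u x = Some z \<and> T_beta T u y = Some z)"
proof -
  have m: "partial_semigroup m" and compact: "compact (UNIV :: 'x set)"
    using assms(1) by (auto simp: pspds_def)
  obtain p z where p: "ultrafilter p" and z: "point_limit T p x z" "point_limit T p y z"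
    by (rule proximal_point_limit[OF assms(2)])
  have pb: "p \<in> beta" using p by (simp add: beta_def)
  obtain L where L: "minimal_left_ideal_beta m L" "L \<subseteq> principal_left_ideal m p"
    by (rule left_ideal_contains_minimal[OF m left_ideal_principal[OF m pb]])
  have "\<exists>w. T_beta T u x = Some w \<and> T_beta T u y = Some w" if "u \<in> L" for u
  proof -
    from that L(2) consider "u = p" | q where "ultrafilter q" "beta_op m q p = Some u"
      by (auto simp: principal_left_ideal_def beta_def)
    then show ?thesis
    proof cases
      case 1
      then show ?thesis using z T_beta_eq_Some[OF p] by blast
    next
      case 2
      \<comment> \<open>Definedness of the product puts \<open>L_beta m p\<close> into
        \<open>q\<close>, and closedness of the domains carries this over to
        \<open>z\<close>.\<close>
      have "L_point T z \<in> q"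
        using beta_op_SomeD(1)[OF 2(2)] L_beta_subset_L_point[OF assms(1) p z(1)]
        by (rule ultrafilter_mono[OF 2(1)])
      then obtain w where w: "point_limit T q z w"
        by (rule point_limit_exists[OF compact 2(1)])
      \<comment> \<open>The orbits of \<open>x\<close> and \<open>y\<close> already share the limit
        \<open>z\<close> along \<open>p\<close>, so a single limit \<open>w\<close> of
        \<open>z\<close> along \<open>q\<close> serves both.\<close>
      have "point_limit T u x w" "point_limit T u y w"
        using point_limit_beta_op[OF assms(1) p 2 _ w] z by blast+
      then show ?thesis using T_beta_eq_Some ultrafilter_beta_op[OF p 2] by blast
    qed
  qed
  then show ?thesis using L(1) by blast
qed

end
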